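(* Let $n\ge 2$ and $r\ge\lfloor n/2\rfloor$ be integers. Then there does not exist an $(r,\le 2)$-identifying code in $\mathbb{F}^n$.
   Context: Let $\mathbb{F}=\{0,1\}$ and let $\mathbb{F}^n$ be the binary Hamming space (hypercube), with Hamming distance $d(x,y)$ = number of coordinates in which $x$ and $y$ differ. For $x\in\mathbb{F}^n$ put $B_r(x)=\{y\in\mathbb{F}^n: d(x,y)\le r\}$, and for $X\subseteq\mathbb{F}^n$ put $B_r(X)=\bigcup_{x\in X}B_r(x)$. A code is a nonempty subset $C\subseteq\mathbb{F}^n$; write $I_r(C;X)=B_r(X)\cap C$ (so $I_r(C;\emptyset)=\emptyset$). For non-negative integers $r,\ell$, a code $C\subseteq\mathbb{F}^n$ is $(r,\le\ell)$-identifying if $I_r(C;X)\ne I_r(C;Y)$ for all $X,Y\subseteq\mathbb{F}^n$ with $|X|\le\ell$, $|Y|\le\ell$ and $X\neq Y$ (the empty set is allowed as $X$ or $Y$). *)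

theory Defs
  imports Main
begin

text \<open>Words of length \<open>n\<close> over \<open>{0, 1}\<close> are Boolean lists, with coordinates numbered from \<open>0\<close>.\<close>

definition hypercube :: "nat \<Rightarrow> bool list set" where
  "hypercube n = {x. length x = n}"

text \<open>Only meant for words of equal length.\<close>

definition hamming_dist :: "bool list \<Rightarrow> bool list \<Rightarrow> nat" where
  "hamming_dist x y = card {i. i < length x \<and> x ! i \<noteq> y ! i}"

definition hamming_ball :: "nat \<Rightarrow> nat \<Rightarrow> bool list \<Rightarrow> bool list set" where
  "hamming_ball n r x = {y \<in> hypercube n. hamming_dist x y \<le> r}"

definition set_ball :: "nat \<Rightarrow> nat \<Rightarrow> bool list set \<Rightarrow> bool list set" where
  "set_ball n r X = (\<Union>x\<in>X. hamming_ball n r x)"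

definition is_code :: "nat \<Rightarrow> bool list set \<Rightarrow> bool" where
  "is_code n C \<longleftrightarrow> C \<noteq> {} \<and> C \<subseteq> hypercube n"

definition I_set :: "nat \<Rightarrow> nat \<Rightarrow> bool list set \<Rightarrow> bool list set \<Rightarrow> bool list set" where
  "I_set n r C X = set_ball n r X \<inter> C"

text \<open>
  Subsets of the hypercube are finite, so \<open>card\<close> is their true size; \<open>X\<close> and \<open>Y\<close> may be empty.
\<close>

definition identifying_code :: "nat \<Rightarrow> nat \<Rightarrow> nat \<Rightarrow> bool list set \<Rightarrow> bool" where
  "identifying_code n r l C \<longleftrightarrow>
     is_code n C \<and>
     (\<forall>X Y. X \<subseteq> hypercube n \<longrightarrow> Y \<subseteq> hypercube n \<longrightarrow>
        card X \<le> l \<longrightarrow> card Y \<le> l \<longrightarrow> X \<noteq> Y \<longrightarrow> I_set n r C X \<noteq> I_set n r C Y)"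

end

theory Submission
  imports Defs
begin

text \<open>
  A word and its complement have distances to any third word that sum to \<open>n\<close>, so one of them is
  at most \<open>n div 2\<close>: the balls around an antipodal pair cover the cube. Hence all antipodal pairs
  have the same identifying set \<open>C\<close>, and for \<open>n \<ge> 2\<close> there is more than one such pair.
\<close>

text \<open>At each coordinate \<open>y\<close> disagrees with exactly one of \<open>x\<close> and
  \<open>map Not x\<close>, so the two disagreement sets partition the index range.\<close>

lemma hamming_dist_complement:
  "hamming_dist x y + hamming_dist (map Not x) y = length x"
proof -
  let ?A = "{i. i < length x \<and> x ! i \<noteq> y ! i}"
  let ?B = "{i. i < length (map Not x) \<and> map Not x ! i \<noteq> y ! i}"
  have "card ?A + card ?B = card (?A \<union> ?B)"
    by (rule card_Un_disjoint [symmetric]) auto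
  also have "?A \<union> ?B = {..<length x}"
    by auto
  finally show ?thesis
    by (simp add: hamming_dist_def)
qed

lemma set_ball_antipodal:
  assumes "x \<in> hypercube n" and "r \<ge> n div 2"
  shows "set_ball n r {x, map Not x} = hypercube n"
proof -
  \<comment> \<open>Were both larger than \<open>r\<close>, their sum would be at least
    \<open>2 * (n div 2) + 2\<close>, which exceeds \<open>n\<close>.\<close>
  have "hamming_dist x y \<le> r \<or> hamming_dist (map Not x) y \<le> r" for y
    using hamming_dist_complement [of x y] assms by (auto simp: hypercube_def)
  then show ?thesis
    by (auto simp: set_ball_def hamming_ball_def)
qed

theorem theorem2:
  fixes n r :: nat
  assumes "n \<ge> 2" and "r \<ge> n div 2"
  shows "\<not> (\<exists>C. identifying_code n r 2 C)"
proof
  assume "\<exists>C. identifying_code n r 2 C"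
  then obtain C where C: "identifying_code n r 2 C" ..
  obtain m where n: "n = Suc (Suc m)"
    using assms(1) by (metis add_2_eq_Suc le_Suc_ex)
  define x where "x = replicate n True"
  \<comment> \<open>As \<open>n \<ge> 2\<close>, \<open>z\<close> contains both letters, so it
    differs from the constant words \<open>x\<close> and \<open>map Not x\<close>.\<close>
  define z where "z = True # replicate (Suc m) False"
  let ?X = "{x, map Not x}" and ?Z = "{z, map Not z}"
  have xz: "x \<in> hypercube n" "z \<in> hypercube n"
    by (auto simp: x_def z_def n hypercube_def)
  then have "?X \<subseteq> hypercube n" "?Z \<subseteq> hypercube n"
    by (auto simp: hypercube_def)
  moreover have "card ?X \<le> 2" "card ?Z \<le> 2"
    by (simp_all add: card_insert_if)
  moreover have "?X \<noteq> ?Z"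
    by (auto simp: x_def z_def n)
  ultimately have "I_set n r C ?X \<noteq> I_set n r C ?Z"
    using C unfolding identifying_code_def by blast
  then show False
    using set_ball_antipodal [OF xz(1) assms(2)] set_ball_antipodal [OF xz(2) assms(2)]
    by (simp add: I_set_def)
qed

end
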